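(* Let $n\ge 2$ and $m\ge n-1$ be integers, and write $m=r(n-1)+t$ with $r=\lfloor m/(n-1)\rfloor$ and $0\le t\le n-2$. Then: (a) the weighted star $S=K_{1,n-1}\in\mathcal{T}(n,m)$ whose edge weights are as equal as possible is the unique weighted tree in $\mathcal{T}(n,m)$ with minimum energy; (b) the minimum energy in $\mathcal{T}(n,m)$ is $\mathbb{E}(S)=2\sqrt{mr+tr+t}$.
   Context: $\mathcal{T}(n,m)$ denotes the set of trees on $n$ vertices in which every edge has a positive integer weight and the sum of all edge weights equals $m$. The energy of a weighted graph $G$ is $\mathbb{E}(G)=\sum_i|\lambda_i|$, where $\lambda_i$ are the eigenvalues of the weighted adjacency matrix (the symmetric matrix whose $(i,j)$ entry is the weight of edge $ij$, or $0$ if there is no such edge). Positive integers $a_1,\dots,a_k$ with sum $m$ are "as equal as possible" if each $a_i$ equals $\lfloor m/k\rfloor$ or $\lfloor m/k\rfloor+1$. $K_{1,n-1}$ is the star with one vertex adjacent to all other $n-1$ vertices. Uniqueness is as weighted graphs (up to isomorphism). *)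

theory Defs
  imports "Jordan_Normal_Form.Spectral_Radius" "HOL-Library.Infinite_Typeclass"
begin

text \<open>The values of \<open>weight\<close> outside \<open>edges\<close> are irrelevant.\<close>

record 'a wgraph =
  verts :: "'a set"
  edges :: "'a set set"
  weight :: "'a set \<Rightarrow> nat"

definition weighted_graph :: "'a wgraph \<Rightarrow> bool" where
  "weighted_graph G \<longleftrightarrow>
     finite (verts G) \<and>
     (\<forall>e\<in>edges G. e \<subseteq> verts G \<and> card e = 2) \<and>
     (\<forall>e\<in>edges G. weight G e > 0)"

definition connected_graph :: "'a wgraph \<Rightarrow> bool" where
  "connected_graph G \<longleftrightarrow>
     verts G \<noteq> {} \<and>
     (\<forall>u\<in>verts G. \<forall>v\<in>verts G. (u, v) \<in> {(x, y). {x, y} \<in> edges G}\<^sup>*)"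

text \<open>A cycle is given by its vertices in cyclic order, without repeating the first one at the end.\<close>

definition is_cycle :: "'a wgraph \<Rightarrow> 'a list \<Rightarrow> bool" where
  "is_cycle G xs \<longleftrightarrow>
     length xs \<ge> 3 \<and> distinct xs \<and>
     (\<forall>i<length xs. {xs ! i, xs ! (Suc i mod length xs)} \<in> edges G)"

definition weighted_tree :: "'a wgraph \<Rightarrow> bool" where
  "weighted_tree G \<longleftrightarrow> weighted_graph G \<and> connected_graph G \<and> (\<nexists>xs. is_cycle G xs)"

definition weighted_trees :: "nat \<Rightarrow> nat \<Rightarrow> 'a wgraph set" where
  "weighted_trees n m =
     {G. weighted_tree G \<and> card (verts G) = n \<and> (\<Sum>e\<in>edges G. weight G e) = m}"

definition wgraph_iso :: "'a wgraph \<Rightarrow> 'b wgraph \<Rightarrow> bool" (infix "\<cong>\<^sub>w" 50) where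
  "G \<cong>\<^sub>w H \<longleftrightarrow>
     (\<exists>f. bij_betw f (verts G) (verts H) \<and>
          (\<forall>u\<in>verts G. \<forall>v\<in>verts G.
             ({u, v} \<in> edges G \<longleftrightarrow> {f u, f v} \<in> edges H) \<and>
             ({u, v} \<in> edges G \<longrightarrow> weight G {u, v} = weight H {f u, f v})))"

definition is_star :: "'a wgraph \<Rightarrow> bool" where
  "is_star G \<longleftrightarrow> (\<exists>c\<in>verts G. edges G = {{c, v} | v. v \<in> verts G - {c}})"

definition as_equal_as_possible :: "('i \<Rightarrow> nat) \<Rightarrow> 'i set \<Rightarrow> bool" where
  "as_equal_as_possible a I \<longleftrightarrow>
     (\<forall>i\<in>I. a i = sum a I div card I \<or> a i = sum a I div card I + 1)"

text \<open>
  Matrices are indexed by natural numbers, so the weighted adjacency matrix is taken with respect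
  to an enumeration of the vertices. The choice of the enumeration is immaterial for the energy,
  see \<open>energy_enum\<close> below.
\<close>

definition adj_matrix :: "'a wgraph \<Rightarrow> 'a list \<Rightarrow> real mat" where
  "adj_matrix G vs = mat (length vs) (length vs)
     (\<lambda>(i, j). if {vs ! i, vs ! j} \<in> edges G then real (weight G {vs ! i, vs ! j}) else 0)"

text \<open>
  Eigenvalues are counted with multiplicity, as roots of the characteristic polynomial. They may
  be taken over the reals, because the adjacency matrix is real symmetric.
\<close>

definition abs_eigenvalue_sum :: "real mat \<Rightarrow> real" where
  "abs_eigenvalue_sum A = (\<Sum>x\<in>spectrum A. real (order x (char_poly A)) * \<bar>x\<bar>)"

definition energy :: "'a wgraph \<Rightarrow> real" where
  "energy G = abs_eigenvalue_sum (adj_matrix G (SOME vs. distinct vs \<and> set vs = verts G))"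

lemma similar_adj_matrix:
  assumes "distinct vs" "distinct ws" "set vs = set ws"
  shows "similar_mat (adj_matrix G vs) (adj_matrix G ws)"
proof -
  define n where "n = length vs"
  have n: "length vs = n" "length ws = n"
    using assms by (auto simp: n_def dest!: distinct_card)
  define P where "P vs ws = mat n n (\<lambda>(i, j). if vs ! i = ws ! j then 1 else 0 :: real)"
    for vs ws :: "'a list"
  have car: "P xs ys \<in> carrier_mat n n" for xs ys by (simp add: P_def)
  have delta: "(\<Sum>k\<in>{0..<n}. (if x = ys ! k then 1 else 0) * g (ys ! k)) = (g x :: real)"
    if "distinct ys" "length ys = n" "x \<in> set ys" for x g and ys :: "'a list"
  proof -
    have "(\<Sum>k\<in>{0..<n}. (if x = ys ! k then 1 else 0) * g (ys ! k)) =
          (\<Sum>y\<in>set ys. (if x = y then 1 else 0) * g y)"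
      by (rule sum.reindex_bij_betw[of "(!) ys"])
         (use that in \<open>auto simp: atLeast0LessThan intro!: bij_betw_nth\<close>)
    also have "\<dots> = (\<Sum>y\<in>set ys. if x = y then g y else 0)"
      by (rule sum.cong) auto
    also have "\<dots> = g x" using that by (simp add: sum.delta)
    finally show ?thesis .
  qed
  have PP: "P xs ys * P ys xs = 1\<^sub>m n"
    if d: "distinct xs" "distinct ys" "length xs = n" "length ys = n" "set xs = set ys" for xs ys
  proof (rule eq_matI)
    fix i j assume "i < dim_row (1\<^sub>m n)" "j < dim_col (1\<^sub>m n)"
    then have ij: "i < n" "j < n" by auto
    have mem: "xs ! i \<in> set ys" using ij d by (metis nth_mem)
    have "(P xs ys * P ys xs) $$ (i, j) =
      (\<Sum>k\<in>{0..<n}. (if xs ! i = ys ! k then 1 else 0) * (if ys ! k = xs ! j then 1 else 0))"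
      using ij by (simp add: P_def scalar_prod_def)
    also have "\<dots> = (if xs ! i = xs ! j then 1 else 0)"
      by (rule delta[OF d(2,4) mem, where g = "\<lambda>y. if y = xs ! j then 1 else 0"])
    finally show "(P xs ys * P ys xs) $$ (i, j) = 1\<^sub>m n $$ (i, j)"
      using ij d by (simp add: nth_eq_iff_index_eq)
  qed (auto simp: P_def)
  define g where "g x y = (if {x, y} \<in> edges G then real (weight G {x, y}) else 0)" for x y
  have adj: "adj_matrix G xs = mat n n (\<lambda>(i, j). g (xs ! i) (xs ! j))" if "length xs = n" for xs
    using that by (simp add: adj_matrix_def g_def)
  have carA: "adj_matrix G xs \<in> carrier_mat n n" if "length xs = n" for xs
    using that by (simp add: adj_matrix_def)
  have dims: "dim_row (adj_matrix G xs) = n" "dim_col (adj_matrix G xs) = n" if "length xs = n" for xs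
    using carA[OF that] by auto
  have sub: "vs ! i \<in> set ws" if "i < n" for i
    using that n assms by (metis nth_mem)
  have 1: "P vs ws * adj_matrix G ws = mat n n (\<lambda>(i, j). g (vs ! i) (ws ! j))" (is "_ = ?B")
  proof (rule eq_matI)
    fix i j assume "i < dim_row ?B" "j < dim_col ?B"
    then have ij: "i < n" "j < n" by auto
    have "(P vs ws * adj_matrix G ws) $$ (i, j) =
        (\<Sum>k\<in>{0..<n}. (if vs ! i = ws ! k then 1 else 0) * g (ws ! k) (ws ! j))"
      using ij n by (simp add: adj P_def scalar_prod_def)
    also have "\<dots> = g (vs ! i) (ws ! j)"
      by (rule delta[OF assms(2) n(2) sub[OF ij(1)], where g = "\<lambda>y. g y (ws ! j)"])
    finally show "(P vs ws * adj_matrix G ws) $$ (i, j) = ?B $$ (i, j)"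
      using ij by simp
  qed (use dims n in \<open>auto simp: P_def\<close>)
  have 2: "?B * P ws vs = adj_matrix G vs"
  proof (rule eq_matI)
    fix i j assume "i < dim_row (adj_matrix G vs)" "j < dim_col (adj_matrix G vs)"
    then have ij: "i < n" "j < n" using dims n by auto
    have "(?B * P ws vs) $$ (i, j) =
        (\<Sum>k\<in>{0..<n}. g (vs ! i) (ws ! k) * (if ws ! k = vs ! j then 1 else 0))"
      using ij n by (simp add: P_def scalar_prod_def)
    also have "\<dots> = (\<Sum>k\<in>{0..<n}. (if vs ! j = ws ! k then 1 else 0) * g (vs ! i) (ws ! k))"
      by (rule sum.cong) auto
    also have "\<dots> = g (vs ! i) (vs ! j)"
      by (rule delta[OF assms(2) n(2) sub[OF ij(2)], where g = "\<lambda>y. g (vs ! i) y"])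
    finally show "(?B * P ws vs) $$ (i, j) = adj_matrix G vs $$ (i, j)"
      using ij n by (simp add: adj)
  qed (use dims n in \<open>auto simp: P_def\<close>)
  have "similar_mat_wit (adj_matrix G vs) (adj_matrix G ws) (P vs ws) (P ws vs)"
    by (rule similar_mat_witI[where n = n]) (simp_all add: n assms 1 2 PP car carA)
  then show ?thesis unfolding similar_mat_def by blast
qed

lemma abs_eigenvalue_sum_similar:
  assumes "similar_mat A B"
  shows "abs_eigenvalue_sum A = abs_eigenvalue_sum B"
proof -
  obtain n where "A \<in> carrier_mat n n" "B \<in> carrier_mat n n"
    using similar_matD[OF assms] by blast
  then show ?thesis
    unfolding abs_eigenvalue_sum_def
    by (simp add: char_poly_similar[OF assms] spectrum_root_char_poly)
qed

lemma energy_enum: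
  assumes "distinct vs" "set vs = verts G"
  shows "energy G = abs_eigenvalue_sum (adj_matrix G vs)"
proof -
  let ?ws = "SOME vs. distinct vs \<and> set vs = verts G"
  have "distinct ?ws \<and> set ?ws = verts G"
    by (rule someI[of _ vs]) (use assms in simp)
  then show ?thesis
    unfolding energy_def using assms
    by (intro abs_eigenvalue_sum_similar similar_adj_matrix) auto
qed

end

theory Submission
  imports Defs
begin

text \<open>The eigenvalues of a weighted tree sum to zero and their squares sum to \<open>2 q\<close>, where \<open>q\<close> is the sum
  of the squared edge weights. Each of them is therefore bounded in absolute value by half the energy
  \<open>E\<close>, so \<open>2 q \<le> E\<^sup>2 / 2\<close>, with equality only if every eigenvalue satisfies \<open>x\<^sup>3 = q x\<close>, that is,
  if the adjacency matrix satisfies \<open>A\<^sup>3 = q A\<close>. This identity holds for stars, and it fails for a tree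
  containing a path on four vertices. Since a forest on \<open>n\<close> vertices has at most \<open>n - 1\<close> edges, \<open>q\<close> is
  smallest for as equal as possible weights on exactly \<open>n - 1\<close> edges.\<close>

section \<open>Real symmetric matrices of trace zero\<close>

text \<open>The passage between the eigenvalues and the identity for \<open>A\<close> is needed in
  both directions: equality in the energy bound must yield the identity for trees, and the identity
  must yield equality for stars. Instead of diagonalizing \<open>A\<close>, the proof takes a Schur
  triangular form and evaluates the trace of the square of M = A^3 - q A twice. The triangular form
  gives the sum of (x^3 - q x)^2 over the eigenvalues, the symmetry of M gives the sum of its
  squared entries, so both vanish together. The condition is x^3 = q x and not x^2 = q because
  equality leaves 0 possible as an eigenvalue. Its matrix form concerns walks of length three, whose
  weights are nonnegative and cannot cancel. The radicand \<open>m * r + t * r + t\<close> equals t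
  (r + 1)^2 + (n - 1 - t) r^2, the value of q for t edges of weight r + 1 and n - 1 - t edges of
  weight r. The two lower bounds, of the energy by q and of q by this value, have separate equality
  cases: the first fixes the shape of the tree, the second its weights.\<close>

definition mat_trace :: "'a::comm_ring_1 mat \<Rightarrow> 'a" where
  "mat_trace A = (\<Sum>i<dim_row A. A $$ (i, i))"

lemma mat_trace_mult:
  assumes "A \<in> carrier_mat n k" "B \<in> carrier_mat k n"
  shows "mat_trace (A * B) = (\<Sum>i<n. \<Sum>j<k. A $$ (i, j) * B $$ (j, i))"
  using assms by (simp add: mat_trace_def scalar_prod_def atLeast0LessThan)

lemma mat_trace_mult_commute:
  assumes "A \<in> carrier_mat n k" "B \<in> carrier_mat k n"
  shows "mat_trace (A * B) = mat_trace (B * A)"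
  unfolding mat_trace_mult[OF assms] mat_trace_mult[OF assms(2,1)]
  by (subst sum.swap) (simp add: mult.commute)

lemma mat_trace_similar_wit:
  assumes "A \<in> carrier_mat n n" "similar_mat_wit A B P Q"
  shows "mat_trace A = mat_trace B"
proof -
  note w = similar_mat_witD2[OF assms]
  have "mat_trace A = mat_trace (P * (B * Q))"
    using w by (simp add: assoc_mult_mat[of P n n B n Q n])
  also have "\<dots> = mat_trace (B * Q * P)"
    using w by (intro mat_trace_mult_commute[of _ n n]) auto
  also have "B * Q * P = B"
    using w by (simp add: assoc_mult_mat[of B n n Q n P n])
  finally show ?thesis .
qed

text \<open>Keeping the witnesses \<open>P\<close> and \<open>Q\<close> fixed, instead of only
  asserting similarity, allows products and differences to be conjugated simultaneously. In this way
  a polynomial in \<open>A\<close> is carried to the same polynomial in its triangular form.\<close>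

lemma similar_mat_wit_mult:
  assumes "A \<in> carrier_mat n n" "similar_mat_wit A B P Q" "similar_mat_wit A' B' P Q" "A' \<in> carrier_mat n n"
  shows "similar_mat_wit (A * A') (B * B') P Q"
proof -
  note w = similar_mat_witD2[OF assms(1,2)] and w' = similar_mat_witD2[OF assms(4,3)]
  have "A * A' = P * B * Q * (P * B' * Q)"
    using w(3) w'(3) by simp
  also have "\<dots> = P * (B * ((Q * P) * (B' * Q)))"
    using w(5-7) w'(5) by (simp add: assoc_mult_mat[of _ n n _ n _ n] mult_carrier_mat[of _ n n _ n])
  also have "\<dots> = P * (B * (B' * Q))"
    using w w' by (simp add: mult_carrier_mat[of _ n n _ n])
  also have "\<dots> = P * (B * B') * Q"
    using w(5-7) w'(5) by (simp add: assoc_mult_mat[of _ n n _ n _ n] mult_carrier_mat[of _ n n _ n])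
  finally show ?thesis
    using w w' by (intro similar_mat_witI[where n = n]) auto
qed

lemma similar_mat_wit_minus:
  fixes A :: "'a::comm_ring_1 mat"
  assumes "A \<in> carrier_mat n n" "similar_mat_wit A B P Q" "similar_mat_wit A' B' P Q" "A' \<in> carrier_mat n n"
  shows "similar_mat_wit (A - A') (B - B') P Q"
proof -
  note w = similar_mat_witD2[OF assms(1,2)] and w' = similar_mat_witD2[OF assms(4,3)]
  have "P * (B - B') * Q = A - A'"
    using w w' by (simp add: mult_minus_distrib_mat[of P n n] minus_mult_distrib_mat[of _ n n _ Q n])
  then show ?thesis
    using w w' by (intro similar_mat_witI[where n = n]) auto
qed

lemma upper_triangular_mult:
  fixes A :: "'a::comm_ring_1 mat"
  assumes "A \<in> carrier_mat n n" "B \<in> carrier_mat n n" "upper_triangular A" "upper_triangular B"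
  shows "upper_triangular (A * B)"
    and "i < n \<Longrightarrow> (A * B) $$ (i, i) = A $$ (i, i) * B $$ (i, i)"
proof -
  \<comment> \<open>In the sum for an entry on or below the diagonal, \<open>k < i\<close> kills the
    first factor and \<open>k > j\<close> the second; only \<open>k = i = j\<close>
    survives.\<close>
  have AB: "A $$ (i, k) * B $$ (k, j) = 0" if "i < n" "k < n" "j \<le> i" "k \<noteq> i \<or> j < i" for i j k
    using assms that by (cases "k < i") (auto simp: upper_triangularD[of A] upper_triangularD[of B])
  show "upper_triangular (A * B)"
  proof (rule upper_triangularI)
    fix i j assume "j < i" "i < dim_row (A * B)"
    then show "(A * B) $$ (i, j) = 0"
      using assms(1,2) by (auto simp: scalar_prod_def intro!: sum.neutral AB)
  qed
  show "(A * B) $$ (i, i) = A $$ (i, i) * B $$ (i, i)" if "i < n"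
  proof -
    have "(A * B) $$ (i, i) = (\<Sum>k<n. A $$ (i, k) * B $$ (k, i))"
      using assms(1,2) that by (simp add: scalar_prod_def atLeast0LessThan)
    also have "\<dots> = (\<Sum>k<n. if k = i then A $$ (i, i) * B $$ (i, i) else 0)"
      using that by (intro sum.cong) (auto simp: AB)
    finally show ?thesis using that by simp
  qed
qed

section \<open>Real spectrum of symmetric matrices\<close>

lemma symmetric_mat_index:
  assumes "A \<in> carrier_mat n n" "A\<^sup>T = A" "i < n" "j < n"
  shows "A $$ (i, j) = A $$ (j, i)"
  using assms by (metis carrier_matD index_transpose_mat(1))

lemma eigenvalue_real_symmetric:
  fixes A :: "real mat"
  assumes A: "A \<in> carrier_mat n n" and sym: "A\<^sup>T = A"
    and ev: "eigenvalue (map_mat complex_of_real A) \<mu>"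
  shows "\<mu> \<in> \<real>"
proof -
  let ?C = "map_mat complex_of_real A"
  from ev obtain v where v: "v \<in> carrier_vec n" "v \<noteq> 0\<^sub>v n" "?C *\<^sub>v v = \<mu> \<cdot>\<^sub>v v"
    using A by (auto simp: eigenvalue_def eigenvector_def)
  have row: "(\<Sum>j<n. of_real (A $$ (i, j)) * v $ j) = \<mu> * v $ i" if "i < n" for i
  proof -
    have "(?C *\<^sub>v v) $ i = (\<Sum>j<n. of_real (A $$ (i, j)) * v $ j)"
      using A v(1) that by (simp add: scalar_prod_def atLeast0LessThan)
    then show ?thesis using v that by simp
  qed
  \<comment> \<open>\<open>S\<close> is the Hermitian form of \<open>A\<close> at the eigenvector
    \<open>v\<close>: it is \<open>\<mu>\<close> times the squared norm \<open>N\<close>, and by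
    symmetry of \<open>A\<close> it equals its own conjugate.\<close>
  define S where "S = (\<Sum>i<n. \<Sum>j<n. of_real (A $$ (i, j)) * v $ j * cnj (v $ i))"
  define N where "N = (\<Sum>i<n. (cmod (v $ i))\<^sup>2)"
  have "S = (\<Sum>i<n. \<mu> * v $ i * cnj (v $ i))"
    unfolding S_def by (intro sum.cong refl) (simp add: row flip: sum_distrib_right)
  also have "\<dots> = \<mu> * of_real N"
    by (simp add: N_def sum_distrib_left mult.assoc complex_norm_square del: of_real_power)
  finally have S: "S = \<mu> * of_real N" .
  have "cnj S = (\<Sum>i<n. \<Sum>j<n. of_real (A $$ (j, i)) * v $ i * cnj (v $ j))"
    by (auto simp: S_def symmetric_mat_index[OF A sym] intro!: sum.cong)
  also have "\<dots> = S"
    unfolding S_def by (rule sum.swap)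
  finally have "S \<in> \<real>" by (simp add: Reals_cnj_iff)
  moreover have "N \<noteq> 0"
  proof
    assume "N = 0"
    then have "v $ i = 0" if "i < n" for i
      using that by (auto simp: N_def sum_nonneg_eq_0_iff)
    then have "v = 0\<^sub>v n" using v(1) by auto
    with v(2) show False ..
  qed
  ultimately show ?thesis
    using S by (metis Reals_divide Reals_of_real nonzero_mult_div_cancel_right of_real_eq_0_iff)
qed

text \<open>The factorization over the complex numbers has only real roots, so it descends along the
  injective embedding of polynomials. The splitting guarantees that the real roots account for the
  whole trace, and it supplies the Schur decomposition over the reals.\<close>

lemma char_poly_real_symmetric_splits:
  fixes A :: "real mat"
  assumes A: "A \<in> carrier_mat n n" and sym: "A\<^sup>T = A"
  shows "\<exists>es. char_poly A = (\<Prod>e\<leftarrow>es. [:- e, 1:])"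
proof -
  interpret mp: map_poly_inj_comm_ring_hom complex_of_real ..
  let ?C = "map_mat complex_of_real A"
  have C: "?C \<in> carrier_mat n n" using A by simp
  from char_poly_factorized[OF C] obtain as where as: "char_poly ?C = (\<Prod>a\<leftarrow>as. [:- a, 1:])"
    by blast
  have real: "a \<in> \<real>" if "a \<in> set as" for a
  proof -
    have "poly (char_poly ?C) a = 0"
      using that unfolding as by (auto simp: poly_prod_list prod_list_zero_iff)
    then show ?thesis
      using eigenvalue_real_symmetric[OF A sym] eigenvalue_root_char_poly[OF C] by blast
  qed
  have "map_poly complex_of_real (\<Prod>e\<leftarrow>map Re as. [:- e, 1:]) = (\<Prod>a\<leftarrow>as. [:- a, 1:])"
    using real
  proof (induction as)
    case (Cons a as)
    have "map_poly complex_of_real [:- Re a, 1:] = [:- a, 1:]"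
      using Cons.prems by simp
    then show ?case
      using Cons by (simp add: mp.hom_mult del: mult_pCons_left mult_pCons_right)
  qed simp
  then have "map_poly complex_of_real (char_poly A) = map_poly complex_of_real (\<Prod>e\<leftarrow>map Re as. [:- e, 1:])"
    using as of_real_hom.char_poly_hom[OF A, where 'a = complex] by simp
  then show ?thesis by (metis mp.injectivity)
qed

lemma sum_order_linear_factors:
  fixes f :: "'a::idom \<Rightarrow> real"
  shows "(\<Sum>x | poly (\<Prod>e\<leftarrow>es. [:- e, 1:]) x = 0. real (order x (\<Prod>e\<leftarrow>es. [:- e, 1:])) * f x) = sum_list (map f es)"
proof -
  have roots: "{x. poly (\<Prod>e\<leftarrow>es. [:- e, 1:]) x = 0} = set es" for es :: "'a list"
    by (induction es) auto
  have order: "order x (\<Prod>e\<leftarrow>es. [:- e, 1:]) = count_list es x" for x and es :: "'a list"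
  proof (induction es)
    case (Cons e es)
    have "(\<Prod>e\<leftarrow>es. [:- e, 1:]) \<noteq> 0" by (auto simp: prod_list_zero_iff)
    then show ?case using Cons
      by (simp add: order_mult order_linear' del: mult_pCons_left)
  qed simp
  \<comment> \<open>The set \<open>X\<close> of surplus points, where the count is 0, lets the index
    set absorb \<open>e\<close> in the induction step whether or not \<open>e\<close> occurs again
    in \<open>es\<close>.\<close>
  have "(\<Sum>x\<in>set es \<union> X. real (count_list es x) * f x) = sum_list (map f es)" if "finite X" for X
    using that
  proof (induction es arbitrary: X)
    case (Cons e es)
    have "(\<Sum>x\<in>set (e # es) \<union> X. real (count_list (e # es) x) * f x) =
      (\<Sum>x\<in>set es \<union> insert e X. real (count_list es x) * f x + (if x = e then f e else 0))"
      by (intro sum.cong) (auto simp: algebra_simps)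
    also have "\<dots> = sum_list (map f es) + f e"
      using Cons.prems Cons.IH[of "insert e X"] by (simp add: sum.distrib)
    finally show ?case by simp
  qed simp
  from this[of "{}"] show ?thesis by (simp add: roots order)
qed

lemma abs_eigenvalue_sum_split:
  assumes "A \<in> carrier_mat n n" "char_poly A = (\<Prod>e\<leftarrow>es. [:- e, 1:])"
  shows "abs_eigenvalue_sum A = (\<Sum>e\<leftarrow>es. \<bar>e\<bar>)"
  using assms sum_order_linear_factors[of es abs]
  by (simp add: abs_eigenvalue_sum_def spectrum_root_char_poly)

section \<open>Eigenvalue sums expressed by matrix entries\<close>

lemma mat_trace_symmetric_square:
  fixes A :: "real mat"
  assumes "A \<in> carrier_mat n n" "A\<^sup>T = A"
  shows "mat_trace (A * A) = (\<Sum>i<n. \<Sum>j<n. (A $$ (i, j))\<^sup>2)"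
  unfolding mat_trace_mult[OF assms(1,1)]
  by (intro sum.cong refl) (simp add: symmetric_mat_index[OF assms] power2_eq_square)

text \<open>All three sums are traces, of \<open>A\<close>, of \<open>A * A\<close> and of the
  square of \<open>A * A * A - q \<cdot>\<^sub>m A\<close>, read off the diagonal of a triangular
  form. For a symmetric matrix the trace of the square is the sum of the squared entries. Hence the
  third identity makes \<open>e ^ 3 = q * e\<close> for all eigenvalues equivalent to the
  corresponding identity for all entries.\<close>

lemma symmetric_eigenvalue_sums:
  fixes A :: "real mat" and q :: real
  assumes A: "A \<in> carrier_mat n n" and sym: "A\<^sup>T = A"
    and split: "char_poly A = (\<Prod>e\<leftarrow>es. [:- e, 1:])"
  shows "(\<Sum>e\<leftarrow>es. e) = mat_trace A"
    and "(\<Sum>e\<leftarrow>es. e\<^sup>2) = (\<Sum>i<n. \<Sum>j<n. (A $$ (i, j))\<^sup>2)"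
    and "(\<Sum>e\<leftarrow>es. (e ^ 3 - q * e)\<^sup>2) =
      (\<Sum>i<n. \<Sum>j<n. ((A * A * A) $$ (i, j) - q * A $$ (i, j))\<^sup>2)"
proof -
  obtain B P Q where "schur_decomposition A es = (B, P, Q)"
    by (cases "schur_decomposition A es")
  from schur_decomposition[OF A split this]
  have sim: "similar_mat_wit A B P Q" and ut: "upper_triangular B" and diag: "diag_mat B = es"
    by auto
  have B: "B \<in> carrier_mat n n" using similar_mat_witD2[OF A sim] by auto
  have es: "es = map (\<lambda>i. B $$ (i, i)) [0..<n]"
    using diag B by (auto simp: diag_mat_def)
  have sum_es: "(\<Sum>e\<leftarrow>es. f e) = (\<Sum>i<n. f (B $$ (i, i)))" for f :: "real \<Rightarrow> real"
    by (simp add: es comp_def interv_sum_list_conv_sum_set_nat atLeast0LessThan)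
  show "(\<Sum>e\<leftarrow>es. e) = mat_trace A"
    unfolding sum_es mat_trace_similar_wit[OF A sim] using B by (simp add: mat_trace_def)
  note AA = similar_mat_wit_mult[OF A sim sim A]
  note AAA = similar_mat_wit_mult[OF mult_carrier_mat[OF A A] AA sim A]
  have "mat_trace (A * A) = mat_trace (B * B)"
    using mat_trace_similar_wit[OF mult_carrier_mat[OF A A] AA] .
  also have "\<dots> = (\<Sum>e\<leftarrow>es. e\<^sup>2)"
    using B unfolding mat_trace_def sum_es
    by (intro sum.cong) (auto simp: upper_triangular_mult[OF B B ut ut] power2_eq_square simp del: index_mult_mat(1))
  finally show "(\<Sum>e\<leftarrow>es. e\<^sup>2) = (\<Sum>i<n. \<Sum>j<n. (A $$ (i, j))\<^sup>2)"
    using mat_trace_symmetric_square[OF A sym] by simp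
  define M where "M = A * A * A - q \<cdot>\<^sub>m A"
  define N where "N = B * B * B - q \<cdot>\<^sub>m B"
  have M: "M \<in> carrier_mat n n" and N: "N \<in> carrier_mat n n"
    using A B by (auto simp: M_def N_def)
  have MN: "similar_mat_wit M N P Q"
    unfolding M_def N_def using A
    by (intro similar_mat_wit_minus[of _ n] AAA similar_mat_wit_smult sim) auto
  have utB2: "upper_triangular (B * B)" and utB3: "upper_triangular (B * B * B)"
    using B ut by (auto intro!: upper_triangular_mult)
  have B2: "B * B \<in> carrier_mat n n" and B3: "B * B * B \<in> carrier_mat n n"
    using B by auto
  have utN: "upper_triangular N"
    using B utB3 ut by (auto simp: N_def upper_triangular_def simp del: index_mult_mat(1))
  have N_diag: "N $$ (i, i) = B $$ (i, i) ^ 3 - q * B $$ (i, i)" if "i < n" for i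
    using B that upper_triangular_mult(2)[OF B B ut ut that] upper_triangular_mult(2)[OF B2 B utB2 ut that]
    unfolding N_def by (simp add: power3_eq_cube del: index_mult_mat(1) assoc_mult_mat)
  have "(A * A * A)\<^sup>T = A * A * A"
    using A sym by (simp add: transpose_mult[of _ n n _ n] assoc_mult_mat[of _ n n _ n _ n])
  moreover have "(q \<cdot>\<^sub>m A)\<^sup>T = q \<cdot>\<^sub>m A\<^sup>T"
    by (intro eq_matI) auto
  ultimately have symM: "M\<^sup>T = M"
    unfolding M_def using A sym
    by (subst transpose_minus[of _ n n]) auto
  have "(\<Sum>e\<leftarrow>es. (e ^ 3 - q * e)\<^sup>2) = mat_trace (N * N)"
    using N unfolding mat_trace_def sum_es
    by (intro sum.cong)
       (auto simp: upper_triangular_mult[OF N N utN utN] N_diag power2_eq_square simp del: index_mult_mat(1))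
  also have "\<dots> = mat_trace (M * M)"
    using mat_trace_similar_wit[OF mult_carrier_mat[OF M M] similar_mat_wit_mult[OF M MN MN M]] by simp
  also have "\<dots> = (\<Sum>i<n. \<Sum>j<n. (M $$ (i, j))\<^sup>2)"
    by (rule mat_trace_symmetric_square[OF M symM])
  also have "\<dots> = (\<Sum>i<n. \<Sum>j<n. ((A * A * A) $$ (i, j) - q * A $$ (i, j))\<^sup>2)"
    using A by (intro sum.cong refl) (simp add: M_def del: index_mult_mat(1))
  finally show "(\<Sum>e\<leftarrow>es. (e ^ 3 - q * e)\<^sup>2) =
      (\<Sum>i<n. \<Sum>j<n. ((A * A * A) $$ (i, j) - q * A $$ (i, j))\<^sup>2)" .
qed

section \<open>The energy bound and its equality case\<close>

text \<open>The entry \<open>x\<close> is minus the sum of the remaining entries, so these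
  contribute at least another \<open>\<bar>x\<bar>\<close>. Removing a single occurrence keeps this
  correct for repeated entries.\<close>

lemma twice_abs_le_sum_abs:
  fixes es :: "real list"
  assumes "sum_list es = 0" "x \<in> set es"
  shows "2 * \<bar>x\<bar> \<le> (\<Sum>e\<leftarrow>es. \<bar>e\<bar>)"
proof -
  have split: "sum_list (map f es) = f x + sum_list (map f (remove1 x es))" for f :: "real \<Rightarrow> real"
    using assms(2) by (rule sum_list_map_remove1)
  have "\<bar>x\<bar> = \<bar>sum_list (remove1 x es)\<bar>"
    using split[of "\<lambda>e. e"] assms(1) by simp
  also have "\<dots> \<le> (\<Sum>e\<leftarrow>remove1 x es. \<bar>e\<bar>)"
    by (rule sum_list_abs)
  finally show ?thesis using split[of abs] by simp
qed

text \<open>Since the eigenvalues sum to zero, \<open>2 * \<bar>x\<bar> \<le> E\<close> for each of them, whence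
  \<open>\<Sum>e\<^sup>2 \<le> E / 2 * \<Sum>\<bar>e\<bar>\<close>; in the case of equality every eigenvalue is \<open>0\<close> or \<open>\<plusminus>E / 2\<close>.\<close>

lemma sum_abs_ge_of_sum_zero:
  fixes es :: "real list" and q :: real
  assumes "sum_list es = 0" "(\<Sum>e\<leftarrow>es. e\<^sup>2) = 2 * q"
  shows "2 * sqrt q \<le> (\<Sum>e\<leftarrow>es. \<bar>e\<bar>)"
    and "(\<Sum>e\<leftarrow>es. \<bar>e\<bar>) = 2 * sqrt q \<Longrightarrow> e \<in> set es \<Longrightarrow> e ^ 3 = q * e"
    and "q > 0 \<Longrightarrow> (\<And>e. e \<in> set es \<Longrightarrow> e ^ 3 = q * e) \<Longrightarrow> (\<Sum>e\<leftarrow>es. \<bar>e\<bar>) = 2 * sqrt q"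
proof -
  define E where "E = (\<Sum>e\<leftarrow>es. \<bar>e\<bar>)"
  have E0: "E \<ge> 0" unfolding E_def by (intro sum_list_nonneg) auto
  have "(\<Sum>e\<leftarrow>es. e\<^sup>2) \<ge> 0" by (intro sum_list_nonneg) auto
  then have q0: "q \<ge> 0" using assms(2) by simp
  have gap: "\<bar>e\<bar> * (E / 2 - \<bar>e\<bar>) \<ge> 0" if "e \<in> set es" for e
    using twice_abs_le_sum_abs[OF assms(1) that] by (simp add: E_def)
  \<comment> \<open>This total slack serves twice: being nonnegative it gives the bound, and when it
    is zero each of its nonnegative summands is zero.\<close>
  have "(\<Sum>e\<leftarrow>es. \<bar>e\<bar> * (E / 2 - \<bar>e\<bar>)) = (\<Sum>e\<leftarrow>es. \<bar>e\<bar> * (E / 2) - e\<^sup>2)"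
    by (simp add: algebra_simps power2_eq_square)
  also have "\<dots> = E\<^sup>2 / 2 - 2 * q"
    by (simp only: sum_list_subtractf sum_list_mult_const assms(2)) (simp add: E_def power2_eq_square)
  finally have gap_sum: "(\<Sum>e\<leftarrow>es. \<bar>e\<bar> * (E / 2 - \<bar>e\<bar>)) = E\<^sup>2 / 2 - 2 * q" .
  have "(\<Sum>e\<leftarrow>es. \<bar>e\<bar> * (E / 2 - \<bar>e\<bar>)) \<ge> 0"
    by (intro sum_list_nonneg) (use gap in auto)
  then have "sqrt q \<le> E / 2"
    using gap_sum E0 by (intro real_le_lsqrt) (auto simp: power_divide)
  then show "2 * sqrt q \<le> (\<Sum>e\<leftarrow>es. \<bar>e\<bar>)" by (simp add: E_def)
  show "e ^ 3 = q * e" if eq: "(\<Sum>e\<leftarrow>es. \<bar>e\<bar>) = 2 * sqrt q" and e: "e \<in> set es"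
  proof -
    have E: "E = 2 * sqrt q" using eq by (simp add: E_def)
    then have "(\<Sum>e\<leftarrow>es. \<bar>e\<bar> * (E / 2 - \<bar>e\<bar>)) = 0"
      unfolding gap_sum using q0 by (simp add: power_mult_distrib)
    then have "\<bar>e\<bar> * (E / 2 - \<bar>e\<bar>) = 0"
      using gap e by (subst (asm) sum_list_nonneg_eq_0_iff) auto
    then have "e = 0 \<or> \<bar>e\<bar> = sqrt q" using E by auto
    then have "e = 0 \<or> e\<^sup>2 = q" using q0 by (metis power2_abs real_sqrt_pow2)
    then show ?thesis by (auto simp: power3_eq_cube power2_eq_square)
  qed
  show "(\<Sum>e\<leftarrow>es. \<bar>e\<bar>) = 2 * sqrt q" if q: "q > 0" and cube: "\<And>e. e \<in> set es \<Longrightarrow> e ^ 3 = q * e"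
  proof -
    \<comment> \<open>The roots of the cubic are 0 and \<plusminus> the square root of
      \<open>q\<close>; on them the absolute value is a multiple of the square, which turns the
      energy into a multiple of the known sum of squares.\<close>
    have "\<bar>e\<bar> = e\<^sup>2 * (1 / sqrt q)" if "e \<in> set es" for e
    proof (cases "e = 0")
      case False
      then have "e\<^sup>2 = q" using cube[OF that] by (simp add: power3_eq_cube power2_eq_square)
      then have "\<bar>e\<bar> = sqrt q" by (metis real_sqrt_abs)
      then show ?thesis using \<open>e\<^sup>2 = q\<close> q by (simp add: real_div_sqrt)
    qed simp
    then have "(\<Sum>e\<leftarrow>es. \<bar>e\<bar>) = (\<Sum>e\<leftarrow>es. e\<^sup>2 * (1 / sqrt q))"
      by (intro arg_cong[of _ _ sum_list] map_cong) auto
    also have "\<dots> = 2 * q * (1 / sqrt q)"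
      by (simp only: sum_list_mult_const assms(2))
    also have "\<dots> = 2 * sqrt q" using q by (simp add: field_simps)
    finally show ?thesis .
  qed
qed

text \<open>Here the list of eigenvalues is eliminated in favour of matrix entries. The factor 2 in
  the hypothesis on the entries anticipates that every edge occurs twice in an adjacency
  matrix.\<close>

lemma real_symmetric_energy:
  fixes A :: "real mat" and q :: real
  assumes A: "A \<in> carrier_mat n n" and sym: "A\<^sup>T = A"
    and tr: "mat_trace A = 0" and q: "(\<Sum>i<n. \<Sum>j<n. (A $$ (i, j))\<^sup>2) = 2 * q"
  shows "2 * sqrt q \<le> abs_eigenvalue_sum A"
    and "abs_eigenvalue_sum A = 2 * sqrt q \<Longrightarrow> i < n \<Longrightarrow> j < n \<Longrightarrow> (A * A * A) $$ (i, j) = q * A $$ (i, j)"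
    and "q > 0 \<Longrightarrow> (\<And>i j. i < n \<Longrightarrow> j < n \<Longrightarrow> (A * A * A) $$ (i, j) = q * A $$ (i, j)) \<Longrightarrow>
      abs_eigenvalue_sum A = 2 * sqrt q"
proof -
  from char_poly_real_symmetric_splits[OF A sym] obtain es
    where es: "char_poly A = (\<Prod>e\<leftarrow>es. [:- e, 1:])" by blast
  note sums = symmetric_eigenvalue_sums[OF A sym es]
  have sum0: "sum_list es = 0" and sum2: "(\<Sum>e\<leftarrow>es. e\<^sup>2) = 2 * q"
    using sums(1,2) tr q by simp_all
  note abs_sum = sum_abs_ge_of_sum_zero[OF sum0 sum2] and split = abs_eigenvalue_sum_split[OF A es]
  show "2 * sqrt q \<le> abs_eigenvalue_sum A" using abs_sum(1) split by simp
  show "(A * A * A) $$ (i, j) = q * A $$ (i, j)"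
    if "abs_eigenvalue_sum A = 2 * sqrt q" "i < n" "j < n"
  proof -
    have "(\<Sum>e\<leftarrow>es. (e ^ 3 - q * e)\<^sup>2) = (\<Sum>e\<leftarrow>es. 0)"
      using abs_sum(2) that(1) split by (intro arg_cong[of _ _ sum_list] map_cong) auto
    then have "(\<Sum>i<n. \<Sum>j<n. ((A * A * A) $$ (i, j) - q * A $$ (i, j))\<^sup>2) = 0"
      using sums(3) by (simp del: index_mult_mat(1))
    then have "((A * A * A) $$ (i, j) - q * A $$ (i, j))\<^sup>2 = 0"
      using that(2,3) by (simp add: sum_nonneg_eq_0_iff sum_nonneg del: index_mult_mat(1))
    then show ?thesis by simp
  qed
  show "abs_eigenvalue_sum A = 2 * sqrt q"
    if "q > 0" and "\<And>i j. i < n \<Longrightarrow> j < n \<Longrightarrow> (A * A * A) $$ (i, j) = q * A $$ (i, j)"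
  proof -
    have "(\<Sum>e\<leftarrow>es. (e ^ 3 - q * e)\<^sup>2) = 0"
      unfolding sums(3)[of q] by (intro sum.neutral ballI) (simp add: that(2) del: index_mult_mat(1))
    then have "e ^ 3 = q * e" if "e \<in> set es" for e
      using that by (subst (asm) sum_list_nonneg_eq_0_iff) auto
    then show ?thesis using abs_sum(3)[OF that(1)] split by simp
  qed
qed

section \<open>Trees and stars\<close>

lemma edge_endpoints:
  assumes "weighted_graph G" "e \<in> edges G"
  obtains u v where "e = {u, v}" "u \<noteq> v" "u \<in> verts G" "v \<in> verts G"
  using assms by (auto simp: weighted_graph_def card_2_iff)

lemma edge_distinct:
  assumes "weighted_graph G" "{u, v} \<in> edges G"
  shows "u \<noteq> v" "u \<in> verts G" "v \<in> verts G"
  using assms by (auto simp: weighted_graph_def)+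

lemma finite_edges:
  assumes "weighted_graph G"
  shows "finite (edges G)"
proof (rule finite_subset)
  show "edges G \<subseteq> Pow (verts G)" "finite (Pow (verts G))"
    using assms by (auto simp: weighted_graph_def)
qed

text \<open>An end of a longest path has no neighbours off the path, and only one on it.\<close>

lemma acyclic_has_leaf:
  assumes G: "weighted_graph G" "\<nexists>xs. is_cycle G xs" and ne: "verts G \<noteq> {}"
  obtains v where "v \<in> verts G" "card {e \<in> edges G. v \<in> e} \<le> 1"
proof -
  define path where "path xs \<longleftrightarrow> xs \<noteq> [] \<and> distinct xs \<and> set xs \<subseteq> verts G \<and>
    (\<forall>i. Suc i < length xs \<longrightarrow> {xs ! i, xs ! Suc i} \<in> edges G)" for xs
  have fin: "finite (verts G)" using G by (simp add: weighted_graph_def)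
  from ne obtain a where "a \<in> verts G" by blast
  then have "path [a]" by (simp add: path_def)
  moreover have "length xs < Suc (card (verts G))" if "path xs" for xs
    using that fin card_mono[OF fin, of "set xs"] by (auto simp: path_def distinct_card)
  ultimately obtain xs where xs: "path xs" and max: "\<And>ys. path ys \<Longrightarrow> length ys \<le> length xs"
    using ex_has_greatest_nat[of path "[a]" length "Suc (card (verts G))"] by (metis less_imp_le)
  from xs obtain v ys where v: "xs = v # ys" by (cases xs) (auto simp: path_def)
  have nbr: "ys \<noteq> [] \<and> u = hd ys" if u: "{v, u} \<in> edges G" for u
  proof -
    note d = edge_distinct[OF G(1) u]
    have "u \<in> set xs"
    proof (rule ccontr)
      assume "u \<notin> set xs"
      then have "path (u # xs)"
        using xs d u unfolding path_def v
        by (auto simp: nth_Cons insert_commute split: nat.splits)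
      from max[OF this] show False by simp
    qed
    then obtain j where j: "j < length xs" "xs ! j = u"
      by (auto simp: in_set_conv_nth)
    have "j \<noteq> 0"
      using d(1) j(2) v by (metis nth_Cons_0)
    \<comment> \<open>A neighbour at position \<open>j \<ge> 2\<close> closes the prefix up to
      \<open>j\<close> into a cycle; the index modulo \<open>Suc j\<close> wraps around to
      \<open>v\<close> at position 0.\<close>
    have "j < 2"
    proof (rule ccontr)
      assume "\<not> j < 2"
      have "is_cycle G (take (Suc j) xs)"
        unfolding is_cycle_def
      proof (intro conjI allI impI)
        show "3 \<le> length (take (Suc j) xs)" using \<open>\<not> j < 2\<close> j by simp
        show "distinct (take (Suc j) xs)" using xs by (simp add: path_def)
        fix i assume "i < length (take (Suc j) xs)"
        then have i: "i < Suc j" by simp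
        show "{take (Suc j) xs ! i, take (Suc j) xs ! (Suc i mod length (take (Suc j) xs))} \<in> edges G"
        proof (cases "i = j")
          case True
          then have "take (Suc j) xs ! (Suc i mod length (take (Suc j) xs)) = v"
            using j(1) v by (simp add: min_absorb2)
          then show ?thesis using True j(2) u by (simp add: insert_commute)
        next
          case False
          then show ?thesis using i j xs by (simp add: path_def min_def)
        qed
      qed
      with G(2) show False by blast
    qed
    with \<open>j \<noteq> 0\<close> have "j = 1" by simp
    with j v show ?thesis by (cases ys) auto
  qed
  \<comment> \<open>If \<open>ys\<close> is empty, \<open>hd ys\<close> is unspecified, but then
    \<open>nbr\<close> excludes every edge at \<open>v\<close> and the left side is empty.\<close>
  have "{e \<in> edges G. v \<in> e} \<subseteq> {{v, hd ys}}"
  proof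
    fix e assume e: "e \<in> {e \<in> edges G. v \<in> e}"
    then obtain a b where ab: "e = {a, b}" "a \<noteq> b" using edge_endpoints[OF G(1)] by blast
    with e have "v = a \<or> v = b" by auto
    then show "e \<in> {{v, hd ys}}"
      using e nbr[of a] nbr[of b] ab by (auto simp: insert_commute)
  qed
  then have "card {e \<in> edges G. v \<in> e} \<le> 1"
    using card_mono[of "{{v, hd ys}}"] by fastforce
  moreover have "v \<in> verts G" using xs v by (simp add: path_def)
  ultimately show thesis using that by blast
qed

text \<open>Deleting a vertex with at most one incident edge costs one vertex and at most one edge.
  The claim is made for acyclic graphs because acyclicity passes to the smaller graph at
  once.\<close>

lemma acyclic_card_edges:
  assumes "weighted_graph G" "\<nexists>xs. is_cycle G xs" "verts G \<noteq> {}"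
  shows "card (edges G) < card (verts G)"
  using assms
proof (induction "card (verts G)" arbitrary: G rule: less_induct)
  case less
  obtain v where v: "v \<in> verts G" "card {e \<in> edges G. v \<in> e} \<le> 1"
    using acyclic_has_leaf[OF less.prems] .
  have fin: "finite (verts G)" using less.prems by (simp add: weighted_graph_def)
  have finE: "finite (edges G)" using finite_edges less.prems by blast
  define H where "H = G\<lparr>verts := verts G - {v}, edges := {e \<in> edges G. v \<notin> e}\<rparr>"
  have cardV: "card (verts G) = Suc (card (verts H))"
    using card.remove[OF fin v(1)] by (simp add: H_def)
  have "edges G = {e \<in> edges G. v \<in> e} \<union> edges H" by (auto simp: H_def)
  then have "card (edges G) \<le> card {e \<in> edges G. v \<in> e} + card (edges H)"
    by (metis card_Un_le)
  then have cardE: "card (edges G) \<le> 1 + card (edges H)" using v(2) by linarith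
  have H: "weighted_graph H"
    using less.prems(1) by (auto simp: weighted_graph_def H_def)
  show ?case
  proof (cases "verts H = {}")
    case True
    \<comment> \<open>Base case of a single vertex: an edge would lie inside \<open>{v}\<close>, yet
      it has two elements.\<close>
    then have "e = {v}" if "e \<in> edges G" "e \<noteq> {}" for e
      using that less.prems(1) by (auto simp: weighted_graph_def H_def)
    then have "edges G = {}"
      using less.prems(1) by (fastforce simp: weighted_graph_def)
    then show ?thesis using cardV by simp
  next
    case False
    have "\<nexists>xs. is_cycle H xs"
      using less.prems(2) by (auto simp: is_cycle_def H_def)
    then show ?thesis
      using less.hyps[OF _ H _ False] cardV cardE by simp
  qed
qed

text \<open>A vertex \<open>c\<close> with two neighbours serves as the centre: a vertex at distance
  two from \<open>c\<close> would, with a second neighbour of \<open>c\<close>, complete a path on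
  four vertices. By connectedness all vertices are then adjacent to \<open>c\<close>, and an edge
  avoiding \<open>c\<close> would form a triangle.\<close>

lemma no_path4_is_star:
  assumes T: "weighted_tree G"
    and no_path: "\<And>a b c d. distinct [a, b, c, d] \<Longrightarrow> {a, b} \<in> edges G \<Longrightarrow> {b, c} \<in> edges G \<Longrightarrow>
      {c, d} \<in> edges G \<Longrightarrow> False"
  shows "is_star G"
proof -
  have G: "weighted_graph G" and conn: "connected_graph G" and acyc: "\<nexists>xs. is_cycle G xs"
    using T by (auto simp: weighted_tree_def)
  define N where "N c = {v. {c, v} \<in> edges G}" for c
  obtain c where c: "c \<in> verts G" and reach: "\<And>v u. v \<in> N c \<Longrightarrow> u \<in> N v \<Longrightarrow> u \<noteq> c \<Longrightarrow> u \<in> N c"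
  proof (cases "\<exists>c x y. x \<in> N c \<and> y \<in> N c \<and> x \<noteq> y")
    case True
    then obtain c x y where cxy: "x \<in> N c" "y \<in> N c" "x \<noteq> y" by blast
    have "u \<in> N c" if v: "v \<in> N c" and u: "u \<in> N v" "u \<noteq> c" for v u
    proof (rule ccontr)
      assume not: "u \<notin> N c"
      obtain z where z: "z \<in> N c" "z \<noteq> v" using cxy by blast
      show False
        by (rule no_path[of z c v u])
           (use z v u not edge_distinct(1)[OF G] in \<open>auto simp: N_def insert_commute\<close>)
    qed
    moreover have "c \<in> verts G" using cxy edge_distinct[OF G] by (auto simp: N_def)
    ultimately show thesis using that by blast
  next
    \<comment> \<open>No vertex has two neighbours, so two steps from \<open>c\<close> lead back to
      \<open>c\<close> and any vertex can be the centre.\<close>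
    case False
    obtain c where "c \<in> verts G" using conn by (auto simp: connected_graph_def)
    moreover have "u = c" if "v \<in> N c" "u \<in> N v" for u v
      using False that by (metis N_def insert_commute mem_Collect_eq)
    ultimately show thesis using that by blast
  qed
  have all: "v = c \<or> v \<in> N c" if "v \<in> verts G" for v
  proof -
    have "(c, v) \<in> {(x, y). {x, y} \<in> edges G}\<^sup>*"
      using conn c that by (simp add: connected_graph_def)
    then show ?thesis
    proof (induction rule: rtrancl_induct)
      case (step y z)
      then show ?case using reach[of y z] by (auto simp: N_def)
    qed simp
  qed
  have "edges G = {{c, v} | v. v \<in> verts G - {c}}"
  proof (intro equalityI subsetI)
    fix e assume e: "e \<in> edges G"
    then obtain u v where uv: "e = {u, v}" "u \<noteq> v" "u \<in> verts G" "v \<in> verts G"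
      using edge_endpoints[OF G] by blast
    have "u = c \<or> v = c"
    proof (rule ccontr)
      assume "\<not> (u = c \<or> v = c)"
      then have "{c, u} \<in> edges G" "{u, v} \<in> edges G" "{v, c} \<in> edges G" "distinct [c, u, v]"
        using all[of u] all[of v] uv e by (auto simp: N_def insert_commute)
      then have "is_cycle G [c, u, v]"
        by (auto simp: is_cycle_def less_Suc_eq)
      with acyc show False by blast
    qed
    then show "e \<in> {{c, v} | v. v \<in> verts G - {c}}"
      using uv by (auto simp: insert_commute)
  next
    fix e assume "e \<in> {{c, v} | v. v \<in> verts G - {c}}"
    then show "e \<in> edges G" using all by (auto simp: N_def)
  qed
  then show ?thesis using c by (auto simp: is_star_def)
qed

section \<open>Sums of squares of integers with a given sum\<close>

text \<open>The integers \<open>a e\<close> satisfy \<open>(a e - r) * (a e - r - 1) \<ge> 0\<close>; the claim is the sum of these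
  inequalities.\<close>

lemma sum_squares_ge:
  fixes a :: "'b \<Rightarrow> nat"
  assumes fin: "finite I" and card: "card I \<le> k" and sum: "sum a I = r * k + t"
  shows "(r * k + t) * r + t * r + t \<le> (\<Sum>i\<in>I. (a i)\<^sup>2)"
    and "(\<Sum>i\<in>I. (a i)\<^sup>2) = (r * k + t) * r + t * r + t \<Longrightarrow> i \<in> I \<Longrightarrow> a i = r \<or> a i = r + 1"
    and "card I = k \<Longrightarrow> (\<And>i. i \<in> I \<Longrightarrow> a i = r \<or> a i = r + 1) \<Longrightarrow>
      (\<Sum>i\<in>I. (a i)\<^sup>2) = (r * k + t) * r + t * r + t"
proof -
  define g where "g i = (int (a i) - int r) * (int (a i) - int r - 1)" for i
  have g0: "g i \<ge> 0" for i
    unfolding g_def zero_le_mult_iff by linarith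
  have "g i = int ((a i)\<^sup>2) - (2 * int r + 1) * int (a i) + int r * (int r + 1)" for i
    by (simp add: g_def algebra_simps power2_eq_square)
  then have "sum g I = int (\<Sum>i\<in>I. (a i)\<^sup>2) - (2 * int r + 1) * int (sum a I)
      + int (card I) * (int r * (int r + 1))"
    by (simp add: sum.distrib sum_subtractf flip: sum_distrib_left)
  also have "\<dots> = int (\<Sum>i\<in>I. (a i)\<^sup>2) - int ((r * k + t) * r + t * r + t)
      - (int k - int (card I)) * (int r * (int r + 1))"
    by (simp add: sum algebra_simps)
  \<comment> \<open>An index missing from a full set of \<open>k\<close> acts like a value 0, at
    which \<open>g\<close> would be \<open>r * (r + 1)\<close>; the last term collects these
    contributions.\<close>
  finally have main: "int (\<Sum>i\<in>I. (a i)\<^sup>2) = int ((r * k + t) * r + t * r + t)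
      + sum g I + (int k - int (card I)) * (int r * (int r + 1))"
    by linarith
  have nn: "(int k - int (card I)) * (int r * (int r + 1)) \<ge> 0" "sum g I \<ge> 0"
    using card g0 by (auto intro: sum_nonneg)
  then show "(r * k + t) * r + t * r + t \<le> (\<Sum>i\<in>I. (a i)\<^sup>2)"
    using main by linarith
  show "a i = r \<or> a i = r + 1" if "(\<Sum>i\<in>I. (a i)\<^sup>2) = (r * k + t) * r + t * r + t" "i \<in> I"
  proof -
    have "sum g I = 0" using main nn that(1) by linarith
    then have "g i = 0" using fin g0 that(2) by (simp add: sum_nonneg_eq_0_iff)
    then show ?thesis by (auto simp: g_def)
  qed
  show "(\<Sum>i\<in>I. (a i)\<^sup>2) = (r * k + t) * r + t * r + t"
    if "card I = k" "\<And>i. i \<in> I \<Longrightarrow> a i = r \<or> a i = r + 1"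
  proof -
    have "g i = 0" if "i \<in> I" for i
      using \<open>\<And>i. i \<in> I \<Longrightarrow> a i = r \<or> a i = r + 1\<close>[OF that] by (auto simp: g_def)
    then have "sum g I = 0" by (intro sum.neutral) auto
    then have "int (\<Sum>i\<in>I. (a i)\<^sup>2) = int ((r * k + t) * r + t * r + t)"
      using main that(1) by simp
    then show ?thesis by (simp only: of_nat_eq_iff)
  qed
qed

text \<open>Each value is \<open>r\<close> plus the indicator of being the larger one, so the excess
  \<open>t\<close> of the sum counts the larger values. The values are thus determined up to order,
  which is the source of uniqueness.\<close>

lemma card_upper_values:
  fixes a :: "'b \<Rightarrow> nat"
  assumes "finite I" "sum a I = r * card I + t" "\<And>i. i \<in> I \<Longrightarrow> a i = r \<or> a i = r + 1"
  shows "card {i \<in> I. a i = r + 1} = t" "card {i \<in> I. a i \<noteq> r + 1} = card I - t"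
proof -
  have "sum a I = (\<Sum>i\<in>I. r + (if a i = r + 1 then 1 else 0))"
    using assms(3) by (intro sum.cong) auto
  also have "\<dots> = r * card I + card {i \<in> I. a i = r + 1}"
    using assms(1) by (simp add: sum.distrib sum.If_cases Int_def)
  finally show t: "card {i \<in> I. a i = r + 1} = t" using assms(2) by simp
  have "{i \<in> I. a i \<noteq> r + 1} = I - {i \<in> I. a i = r + 1}" by auto
  then show "card {i \<in> I. a i \<noteq> r + 1} = card I - t"
    using assms(1) t by (simp add: card_Diff_subset)
qed

section \<open>Stars and their isomorphisms\<close>

lemma star_edges_bij:
  assumes "edges G = {{c, v} | v. v \<in> verts G - {c}}"
  shows "bij_betw (\<lambda>v. {c, v}) (verts G - {c}) (edges G)"
  unfolding bij_betw_def assms by (auto simp: inj_on_def doubleton_eq_iff)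

lemma star_tree:
  assumes "finite (verts G)" "c \<in> verts G" "edges G = {{c, v} | v. v \<in> verts G - {c}}"
    and "\<And>v. v \<in> verts G - {c} \<Longrightarrow> weight G {c, v} > 0"
  shows "weighted_tree G"
  unfolding weighted_tree_def
proof (intro conjI notI)
  show "weighted_graph G"
    using assms by (auto simp: weighted_graph_def)
  have adj: "(c, v) \<in> {(x, y). {x, y} \<in> edges G}\<^sup>*" "(v, c) \<in> {(x, y). {x, y} \<in> edges G}\<^sup>*"
    if "v \<in> verts G" for v
    using that assms(3) by (cases "v = c"; auto simp: insert_commute intro!: r_into_rtrancl)+
  show "connected_graph G"
    unfolding connected_graph_def using assms(2) rtrancl_trans[OF adj(2) adj(1)] by blast
  assume "\<exists>xs. is_cycle G xs"
  then obtain xs where xs: "length xs \<ge> 3" "distinct xs"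
    and e: "\<And>i. i < length xs \<Longrightarrow> {xs ! i, xs ! (Suc i mod length xs)} \<in> edges G"
    by (auto simp: is_cycle_def)
  have c_in: "c \<in> {xs ! i, xs ! (Suc i mod length xs)}" if "i < length xs" for i
    using e[OF that] assms(3) by auto
  have ne: "xs \<noteq> []" using xs(1) by auto
  \<comment> \<open>All edges contain \<open>c\<close>. The first two edges of the cycle share only
    \<open>xs ! 1\<close>, which the third one avoids; in a triangle the modulus makes its far end
    \<open>xs ! 0\<close>.\<close>
  have "c \<in> {xs ! 0, xs ! 1}" "c \<in> {xs ! 1, xs ! 2}" "c \<in> {xs ! 2, xs ! (3 mod length xs)}"
    using c_in[of 0] c_in[of 1] c_in[of 2] xs(1) ne
    by (simp_all add: numeral_2_eq_2 numeral_3_eq_3)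
  moreover have "xs ! 0 \<noteq> xs ! 2" "xs ! 1 \<noteq> xs ! 2" "xs ! 1 \<noteq> xs ! 0"
    using xs ne by (simp_all add: nth_eq_iff_index_eq)
  moreover have "xs ! 1 \<noteq> xs ! (3 mod length xs)"
    using xs by (cases "length xs = 3") (auto simp: nth_eq_iff_index_eq)
  ultimately show False by auto
qed

lemma star_card_edges:
  assumes "is_star G" "finite (verts G)"
  shows "card (edges G) = card (verts G) - 1"
proof -
  obtain c where c: "c \<in> verts G" "edges G = {{c, v} | v. v \<in> verts G - {c}}"
    using assms(1) by (auto simp: is_star_def)
  then show ?thesis
    using bij_betw_same_card[OF star_edges_bij[OF c(2)]] by simp
qed

text \<open>It is enough to match the leaves with their weights, since the bijection extends by
  sending centre to centre.\<close>

lemma star_iso: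
  assumes G: "c \<in> verts G" "edges G = {{c, v} | v. v \<in> verts G - {c}}"
    and H: "d \<in> verts H" "edges H = {{d, v} | v. v \<in> verts H - {d}}"
    and f: "bij_betw f (verts G - {c}) (verts H - {d})"
      "\<And>v. v \<in> verts G - {c} \<Longrightarrow> weight G {c, v} = weight H {d, f v}"
  shows "G \<cong>\<^sub>w H"
proof -
  define h where "h v = (if v = c then d else f v)" for v
  have "bij_betw h (verts G - {c}) (verts H - {d})"
    using f(1) by (rule bij_betw_cong[THEN iffD1, rotated]) (simp add: h_def)
  from notIn_Un_bij_betw[of c _ h, OF _ _ this]
  have "bij_betw h (insert c (verts G - {c})) (insert d (verts H - {d}))"
    by (simp add: h_def)
  then have h: "bij_betw h (verts G) (verts H)"
    using G(1) H(1) by (simp add: insert_absorb)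
  have hd: "h v = d \<longleftrightarrow> v = c" if "v \<in> verts G" for v
    using f(1) that by (auto simp: h_def bij_betw_def)
  have edgeG: "{u, v} \<in> edges G \<longleftrightarrow> (u = c \<or> v = c) \<and> u \<noteq> v" if "u \<in> verts G" "v \<in> verts G" for u v
    using that unfolding G(2) by (auto simp: doubleton_eq_iff)
  have edgeH: "{u, v} \<in> edges H \<longleftrightarrow> (u = d \<or> v = d) \<and> u \<noteq> v" if "u \<in> verts H" "v \<in> verts H" for u v
    using that unfolding H(2) by (auto simp: doubleton_eq_iff)
  have hV: "h v \<in> verts H" if "v \<in> verts G" for v using h that by (auto simp: bij_betw_def)
  have inj: "h u = h v \<longleftrightarrow> u = v" if "u \<in> verts G" "v \<in> verts G" for u v
    using h that by (auto simp: bij_betw_def inj_on_def)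
  have wc: "weight G {c, v} = weight H {d, h v}" if "v \<in> verts G" "v \<noteq> c" for v
    using f(2) that by (simp add: h_def)
  have "weight G {u, v} = weight H {h u, h v}"
    if "u \<in> verts G" "v \<in> verts G" "{u, v} \<in> edges G" for u v
    using that edgeG[OF that(1,2)] wc[of u] wc[of v] by (auto simp: h_def[of c] insert_commute)
  then show ?thesis
    unfolding wgraph_iso_def using h edgeG edgeH hV inj hd by (intro exI[of _ h]) auto
qed

text \<open>Glues a bijection between the elements satisfying the predicates to one between the
  others. It will match leaves of heavy edges with leaves of heavy edges.\<close>

lemma bij_betw_match_predicate:
  assumes "finite A" "finite B" "card {x \<in> A. P x} = card {x \<in> B. Q x}"
    "card {x \<in> A. \<not> P x} = card {x \<in> B. \<not> Q x}"
  obtains f where "bij_betw f A B" "\<And>x. x \<in> A \<Longrightarrow> P x \<longleftrightarrow> Q (f x)"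
proof -
  obtain f where f: "bij_betw f {x \<in> A. P x} {x \<in> B. Q x}"
    using finite_same_card_bij[of "{x \<in> A. P x}" "{x \<in> B. Q x}"] assms by auto
  obtain g where g: "bij_betw g {x \<in> A. \<not> P x} {x \<in> B. \<not> Q x}"
    using finite_same_card_bij[of "{x \<in> A. \<not> P x}" "{x \<in> B. \<not> Q x}"] assms by auto
  let ?h = "\<lambda>x. if P x then f x else g x"
  have "bij_betw ?h ({x \<in> A. P x} \<union> {x \<in> A. \<not> P x}) ({x \<in> B. Q x} \<union> {x \<in> B. \<not> Q x})"
  proof (rule bij_betw_combine)
    show "bij_betw ?h {x \<in> A. P x} {x \<in> B. Q x}"
      using f by (rule bij_betw_cong[THEN iffD1, rotated]) simp
    show "bij_betw ?h {x \<in> A. \<not> P x} {x \<in> B. \<not> Q x}"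
      using g by (rule bij_betw_cong[THEN iffD1, rotated]) simp
  qed auto
  moreover have "{x \<in> A. P x} \<union> {x \<in> A. \<not> P x} = A" "{x \<in> B. Q x} \<union> {x \<in> B. \<not> Q x} = B" by auto
  ultimately have "bij_betw ?h A B" by simp
  moreover have "P x \<longleftrightarrow> Q (?h x)" if "x \<in> A" for x
    using f g that by (auto simp: bij_betw_def)
  ultimately show thesis using that by blast
qed

section \<open>Energy of weighted trees\<close>

text \<open>Matrix entries indexed by vertices, so that sums over walks do not refer to an
  enumeration.\<close>

definition adj :: "'a wgraph \<Rightarrow> 'a \<Rightarrow> 'a \<Rightarrow> real" where
  "adj G u v = (if {u, v} \<in> edges G then real (weight G {u, v}) else 0)"

text \<open>This is the quantity \<open>q\<close> of the energy bound, kept as a natural number so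
  that it can be minimized by integer arithmetic.\<close>

definition sq_weight :: "'a wgraph \<Rightarrow> nat" where
  "sq_weight G = (\<Sum>e\<in>edges G. (weight G e)\<^sup>2)"

lemma adj_commute: "adj G u v = adj G v u"
  by (simp add: adj_def insert_commute)

lemma adj_nonneg: "adj G u v \<ge> 0"
  by (simp add: adj_def)

text \<open>Ordered pairs of adjacent vertices are grouped by their edge; as edges have two distinct
  ends, each group has exactly two members.\<close>

lemma sum_adj_squared:
  assumes G: "weighted_graph G"
  shows "(\<Sum>u\<in>verts G. \<Sum>v\<in>verts G. (adj G u v)\<^sup>2) = 2 * real (sq_weight G)"
proof -
  define S where "S = {(u, v). {u, v} \<in> edges G}"
  define g where "g p = {fst p, snd p}" for p :: "'a \<times> 'a"
  have finV: "finite (verts G)" using G by (simp add: weighted_graph_def)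
  have S: "S \<subseteq> verts G \<times> verts G" using edge_distinct[OF G] by (auto simp: S_def)
  then have finS: "finite S" using finV finite_subset by blast
  have "(\<Sum>u\<in>verts G. \<Sum>v\<in>verts G. (adj G u v)\<^sup>2) = (\<Sum>(u, v)\<in>verts G \<times> verts G. (adj G u v)\<^sup>2)"
    by (rule sum.cartesian_product)
  also have "\<dots> = (\<Sum>p\<in>S. (real (weight G (g p)))\<^sup>2)"
    using finV S by (intro sum.mono_neutral_cong_right) (auto simp: S_def adj_def g_def split: if_splits)
  also have "\<dots> = (\<Sum>e\<in>edges G. \<Sum>p\<in>{p \<in> S. g p = e}. (real (weight G (g p)))\<^sup>2)"
    using finS finite_edges[OF G] by (intro sum.group[symmetric]) (auto simp: S_def g_def)
  also have "\<dots> = (\<Sum>e\<in>edges G. 2 * (real (weight G e))\<^sup>2)"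
  proof (rule sum.cong[OF refl])
    fix e assume e: "e \<in> edges G"
    then obtain u v where uv: "e = {u, v}" "u \<noteq> v" using edge_endpoints[OF G] by blast
    then have "{p \<in> S. g p = e} = {(u, v), (v, u)}"
      using e by (auto simp: S_def g_def doubleton_eq_iff insert_commute)
    then show "(\<Sum>p\<in>{p \<in> S. g p = e}. (real (weight G (g p)))\<^sup>2) = 2 * (real (weight G e))\<^sup>2"
      using uv by (simp add: g_def insert_commute)
  qed
  also have "\<dots> = 2 * real (sq_weight G)"
    by (simp add: sq_weight_def sum_distrib_left)
  finally show ?thesis .
qed

text \<open>The entries of the cube of the adjacency matrix are the total weights of walks of length
  three, which moves the matrix criterion to the graph.\<close>

lemma energy_bounds:
  assumes G: "weighted_graph G"
  shows "2 * sqrt (sq_weight G) \<le> energy G"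
    and "energy G = 2 * sqrt (sq_weight G) \<Longrightarrow> u \<in> verts G \<Longrightarrow> v \<in> verts G \<Longrightarrow>
      (\<Sum>x\<in>verts G. \<Sum>y\<in>verts G. adj G u x * adj G x y * adj G y v) = sq_weight G * adj G u v"
    and "sq_weight G > 0 \<Longrightarrow> (\<And>u v. u \<in> verts G \<Longrightarrow> v \<in> verts G \<Longrightarrow>
      (\<Sum>x\<in>verts G. \<Sum>y\<in>verts G. adj G u x * adj G x y * adj G y v) = sq_weight G * adj G u v) \<Longrightarrow>
      energy G = 2 * sqrt (sq_weight G)"
proof -
  have finV: "finite (verts G)" using G by (simp add: weighted_graph_def)
  obtain vs where vs: "distinct vs" "set vs = verts G"
    using finite_distinct_list[OF finV] by blast
  define n where "n = length vs"
  define A where "A = adj_matrix G vs"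
  have A: "A \<in> carrier_mat n n" by (simp add: A_def n_def adj_matrix_def)
  have A_adj: "A $$ (i, j) = adj G (vs ! i) (vs ! j)" if "i < n" "j < n" for i j
    using that by (simp add: A_def n_def adj_matrix_def adj_def)
  have sum_vs: "(\<Sum>i<n. f (vs ! i)) = (\<Sum>v\<in>verts G. f v)" for f :: "'a \<Rightarrow> real"
    by (rule sum.reindex_bij_betw) (use vs in \<open>auto simp: n_def intro!: bij_betw_nth\<close>)
  have AAA: "(A * A * A) $$ (i, j) =
      (\<Sum>x\<in>verts G. \<Sum>y\<in>verts G. adj G (vs ! i) x * adj G x y * adj G y (vs ! j))" if "i < n" "j < n" for i j
  proof -
    have "(A * A * A) $$ (i, j) = (\<Sum>k<n. (\<Sum>l<n. A $$ (i, l) * A $$ (l, k)) * A $$ (k, j))"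
      using A that by (simp add: scalar_prod_def atLeast0LessThan del: assoc_mult_mat)
    also have "\<dots> = (\<Sum>k<n. \<Sum>l<n. adj G (vs ! i) (vs ! l) * adj G (vs ! l) (vs ! k) * adj G (vs ! k) (vs ! j))"
      using that by (simp add: A_adj sum_distrib_right)
    also have "\<dots> = (\<Sum>y\<in>verts G. \<Sum>x\<in>verts G. adj G (vs ! i) x * adj G x y * adj G y (vs ! j))"
      by (simp only: sum_vs[of "\<lambda>x. adj G (vs ! i) x * adj G x y * adj G y (vs ! j)" for y]
          sum_vs[of "\<lambda>y. \<Sum>x\<in>verts G. adj G (vs ! i) x * adj G x y * adj G y (vs ! j)"])
    finally show ?thesis by (subst sum.swap)
  qed
  have en: "energy G = abs_eigenvalue_sum A"
    unfolding A_def by (rule energy_enum[OF vs])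
  have sym: "A\<^sup>T = A"
    using A by (intro eq_matI) (auto simp: A_adj adj_commute)
  have "adj G v v = 0" for v
    using edge_distinct(1)[OF G, of v v] by (auto simp: adj_def)
  then have tr: "mat_trace A = 0"
    using A by (simp add: mat_trace_def A_adj)
  have "(\<Sum>i<n. \<Sum>j<n. (A $$ (i, j))\<^sup>2) = (\<Sum>i<n. \<Sum>j<n. (adj G (vs ! i) (vs ! j))\<^sup>2)"
    by (simp add: A_adj)
  also have "\<dots> = (\<Sum>u\<in>verts G. \<Sum>v\<in>verts G. (adj G u v)\<^sup>2)"
    by (simp only: sum_vs[of "\<lambda>v. (adj G u v)\<^sup>2" for u] sum_vs[of "\<lambda>u. \<Sum>v\<in>verts G. (adj G u v)\<^sup>2"])
  finally have q: "(\<Sum>i<n. \<Sum>j<n. (A $$ (i, j))\<^sup>2) = 2 * real (sq_weight G)"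
    by (simp add: sum_adj_squared[OF G])
  note energy = real_symmetric_energy[OF A sym tr q, folded en]
  show "2 * sqrt (sq_weight G) \<le> energy G" by (rule energy(1))
  show "(\<Sum>x\<in>verts G. \<Sum>y\<in>verts G. adj G u x * adj G x y * adj G y v) = sq_weight G * adj G u v"
    if "energy G = 2 * sqrt (sq_weight G)" "u \<in> verts G" "v \<in> verts G"
  proof -
    obtain i j where ij: "i < n" "vs ! i = u" "j < n" "vs ! j = v"
      using \<open>u \<in> verts G\<close> \<open>v \<in> verts G\<close> vs(2) n_def by (metis in_set_conv_nth)
    show ?thesis
      using energy(2)[OF that(1) ij(1,3)] unfolding AAA[OF ij(1,3)] A_adj[OF ij(1,3)] ij(2,4) .
  qed
  show "energy G = 2 * sqrt (sq_weight G)"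
    if "sq_weight G > 0" and cube: "\<And>u v. u \<in> verts G \<Longrightarrow> v \<in> verts G \<Longrightarrow>
      (\<Sum>x\<in>verts G. \<Sum>y\<in>verts G. adj G u x * adj G x y * adj G y v) = sq_weight G * adj G u v"
  proof (rule energy(3))
    fix i j assume ij: "i < n" "j < n"
    then have "vs ! i \<in> verts G" "vs ! j \<in> verts G" unfolding n_def vs(2)[symmetric] by simp_all
    from cube[OF this] show "(A * A * A) $$ (i, j) = real (sq_weight G) * A $$ (i, j)"
      unfolding AAA[OF ij] A_adj[OF ij] .
  qed (use that in simp)
qed

text \<open>By equality in the energy bound, a walk of length three from \<open>a\<close> to \<open>d\<close> forces an edge between
  \<open>a\<close> and \<open>d\<close>, so a path on four vertices would close up to a cycle.\<close>

lemma tree_min_energy_is_star: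
  assumes T: "weighted_tree G"
    and eq: "energy G = 2 * sqrt (sq_weight G)"
  shows "is_star G"
proof (rule no_path4_is_star[OF T])
  fix a b c d
  assume dist: "distinct [a, b, c, d]" and e: "{a, b} \<in> edges G" "{b, c} \<in> edges G" "{c, d} \<in> edges G"
  have G: "weighted_graph G" and acyc: "\<nexists>xs. is_cycle G xs"
    using T by (auto simp: weighted_tree_def)
  have finV: "finite (verts G)" using G by (simp add: weighted_graph_def)
  have V: "a \<in> verts G" "b \<in> verts G" "c \<in> verts G" "d \<in> verts G"
    using e edge_distinct[OF G] by blast+
  have pos: "adj G u v > 0" if "{u, v} \<in> edges G" for u v
    using that G by (auto simp: adj_def weighted_graph_def)
  have "{a, d} \<notin> edges G"
  proof
    assume "{a, d} \<in> edges G"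
    then have "is_cycle G [a, b, c, d]"
      using e dist by (auto simp: is_cycle_def less_Suc_eq insert_commute)
    with acyc show False by blast
  qed
  then have "(\<Sum>x\<in>verts G. \<Sum>y\<in>verts G. adj G a x * adj G x y * adj G y d) = 0"
    using energy_bounds(2)[OF G eq V(1,4)] by (simp add: adj_def[of G a d])
  \<comment> \<open>Since all terms are nonnegative, the single walk through \<open>b\<close> and
    \<open>c\<close> already makes the sum positive.\<close>
  moreover have "0 < adj G a b * adj G b c * adj G c d"
    using pos e by simp
  moreover have "adj G a b * adj G b c * adj G c d \<le> (\<Sum>y\<in>verts G. adj G a b * adj G b y * adj G y d)"
    using finV V(3) by (intro member_le_sum[of c _ "\<lambda>y. adj G a b * adj G b y * adj G y d"]) (auto simp: adj_nonneg)
  moreover have "\<dots> \<le> (\<Sum>x\<in>verts G. \<Sum>y\<in>verts G. adj G a x * adj G x y * adj G y d)"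
    using finV V(2)
    by (intro member_le_sum[of b _ "\<lambda>x. \<Sum>y\<in>verts G. adj G a x * adj G x y * adj G y d"])
       (auto simp: adj_nonneg intro!: sum_nonneg)
  ultimately show False by linarith
qed

text \<open>With \<open>w\<close> the vector of weights at the centre \<open>c\<close> and u the
  unit vector of \<open>c\<close>, the matrix is w u^T + u w^T. As \<open>w c = 0\<close>, its
  square is w w^T + q u u^T, which is \<open>walk2\<close>, and one more multiplication gives q
  times the matrix.\<close>

lemma star_energy:
  assumes G: "weighted_graph G" and star: "is_star G" and n: "card (verts G) \<ge> 2"
  shows "energy G = 2 * sqrt (sq_weight G)"
proof (rule energy_bounds(3)[OF G])
  have finV: "finite (verts G)" using G by (simp add: weighted_graph_def)
  obtain c where c: "c \<in> verts G" "edges G = {{c, v} | v. v \<in> verts G - {c}}"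
    using star by (auto simp: is_star_def)
  have "edges G \<noteq> {}"
    using star_card_edges[OF star finV] n by auto
  then obtain e where "e \<in> edges G" by blast
  moreover from this have "weight G e > 0" using G by (simp add: weighted_graph_def)
  ultimately show "0 < sq_weight G"
    unfolding sq_weight_def by (intro sum_pos2[OF finite_edges[OF G]]) auto
  define w where "w v = adj G c v" for v
  have adj0: "adj G u v = 0" if "u \<noteq> c" "v \<noteq> c" for u v
    using that by (auto simp: adj_def c(2) doubleton_eq_iff)
  have adjw: "adj G u c = w u" "adj G c u = w u" for u
    by (simp_all add: w_def adj_commute)
  have w0: "w c = 0"
    using edge_distinct(1)[OF G, of c c] by (auto simp: w_def adj_def)
  have "real (sq_weight G) = (\<Sum>v\<in>verts G - {c}. (real (weight G {c, v}))\<^sup>2)"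
    by (simp add: sq_weight_def flip: sum.reindex_bij_betw[OF star_edges_bij[OF c(2)]])
  also have "\<dots> = (\<Sum>v\<in>verts G - {c}. w v * w v)"
    by (intro sum.cong) (auto simp: w_def adj_def c(2) power2_eq_square)
  also have "\<dots> = (\<Sum>v\<in>verts G. w v * w v)"
    using finV c(1) by (simp add: sum.remove[of _ c] w0)
  finally have q: "(\<Sum>v\<in>verts G. w v * w v) = real (sq_weight G)" by simp
  have single: "(\<Sum>x\<in>verts G. f x) = f c" if "\<And>x. x \<noteq> c \<Longrightarrow> f x = 0" for f :: "'a \<Rightarrow> real"
    using finV c(1) that by (simp add: sum.remove[of _ c])
  have walk2: "(\<Sum>y\<in>verts G. adj G x y * adj G y v) =
      (if x = c then if v = c then real (sq_weight G) else 0 else w x * w v)" for x v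
  proof (cases "x = c \<and> v = c")
    case True
    then show ?thesis by (simp add: adjw q)
  next
    case False
    then have "(\<Sum>y\<in>verts G. adj G x y * adj G y v) = adj G x c * adj G c v"
      by (intro single) (auto simp: adj0)
    then show ?thesis using False by (auto simp: adjw w0)
  qed
  show "(\<Sum>x\<in>verts G. \<Sum>y\<in>verts G. adj G u x * adj G x y * adj G y v) = sq_weight G * adj G u v" for u v
  proof -
    have "(\<Sum>x\<in>verts G. \<Sum>y\<in>verts G. adj G u x * adj G x y * adj G y v) =
        (\<Sum>x\<in>verts G. adj G u x * (\<Sum>y\<in>verts G. adj G x y * adj G y v))"
      by (simp add: sum_distrib_left mult.assoc)
    also have "\<dots> = (\<Sum>x\<in>verts G. adj G u x *
        (if x = c then if v = c then real (sq_weight G) else 0 else w x * w v))"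
      by (simp only: walk2)
    also have "\<dots> = sq_weight G * adj G u v"
    proof (cases "u = c")
      case True
      have "(\<Sum>x\<in>verts G. adj G u x * (if x = c then if v = c then real (sq_weight G) else 0 else w x * w v)) =
          (\<Sum>x\<in>verts G. w x * w x * w v)"
        using True by (intro sum.cong) (auto simp: adjw w0)
      also have "\<dots> = sq_weight G * w v" by (simp add: q flip: sum_distrib_right)
      finally show ?thesis using True by (simp add: adjw)
    next
      case False
      then show ?thesis by (subst single) (auto simp: adj0 adjw)
    qed
    finally show ?thesis .
  qed
qed

section \<open>Uniqueness and existence of the star with equal weights\<close>

text \<open>Both stars have exactly \<open>t\<close> edges of weight \<open>r + 1\<close>, and every
  other edge has weight \<open>r\<close>, so matching heavy edges preserves all weights.\<close>

lemma equal_stars_iso: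
  assumes G: "finite (verts G)" "is_star G" "card (verts G) = n" "sum (weight G) (edges G) = r * (n - 1) + t"
      "\<And>e. e \<in> edges G \<Longrightarrow> weight G e = r \<or> weight G e = r + 1"
    and H: "finite (verts H)" "is_star H" "card (verts H) = n" "sum (weight H) (edges H) = r * (n - 1) + t"
      "\<And>e. e \<in> edges H \<Longrightarrow> weight H e = r \<or> weight H e = r + 1"
  shows "G \<cong>\<^sub>w H"
proof -
  obtain c where c: "c \<in> verts G" "edges G = {{c, v} | v. v \<in> verts G - {c}}"
    using G(2) by (auto simp: is_star_def)
  obtain d where d: "d \<in> verts H" "edges H = {{d, v} | v. v \<in> verts H - {d}}"
    using H(2) by (auto simp: is_star_def)
  have val: "weight G {c, v} = r \<or> weight G {c, v} = r + 1" if "v \<in> verts G - {c}" for v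
    using G(5)[of "{c, v}"] that c(2) by blast
  have val': "weight H {d, v} = r \<or> weight H {d, v} = r + 1" if "v \<in> verts H - {d}" for v
    using H(5)[of "{d, v}"] that d(2) by blast
  have sum: "(\<Sum>v\<in>verts G - {c}. weight G {c, v}) = r * card (verts G - {c}) + t"
    using G(1,3,4) c(1) by (simp add: sum.reindex_bij_betw[OF star_edges_bij[OF c(2)]])
  have sum': "(\<Sum>v\<in>verts H - {d}. weight H {d, v}) = r * card (verts H - {d}) + t"
    using H(1,3,4) d(1) by (simp add: sum.reindex_bij_betw[OF star_edges_bij[OF d(2)]])
  have card: "card (verts G - {c}) = card (verts H - {d})"
    using G(1,3) H(1,3) c(1) d(1) by simp
  note cards = card_upper_values[OF _ sum val] card_upper_values[OF _ sum' val']
  obtain f where f: "bij_betw f (verts G - {c}) (verts H - {d})"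
    and fw: "\<And>v. v \<in> verts G - {c} \<Longrightarrow> weight G {c, v} = r + 1 \<longleftrightarrow> weight H {d, f v} = r + 1"
    by (rule bij_betw_match_predicate[of "verts G - {c}" "verts H - {d}" "\<lambda>v. weight G {c, v} = r + 1"
        "\<lambda>v. weight H {d, v} = r + 1"]) (use G(1) H(1) cards card in auto)
  have "weight G {c, v} = weight H {d, f v}" if v: "v \<in> verts G - {c}" for v
  proof -
    have "f v \<in> verts H - {d}" using f v by (auto simp: bij_betw_def)
    then show ?thesis using val[OF v] val' fw[OF v] by metis
  qed
  then show ?thesis
    by (rule star_iso[OF c d f])
qed

lemma equal_star_exists:
  assumes "n \<ge> 2" "r > 0" "t \<le> n - 1"
  obtains S :: "'a::infinite wgraph" where "S \<in> weighted_trees n (r * (n - 1) + t)" "is_star S"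
    "\<And>e. e \<in> edges S \<Longrightarrow> weight S e = r \<or> weight S e = r + 1"
proof -
  obtain V :: "'a set" where V: "finite V" "card V = n"
    using infinite_arbitrarily_large[OF infinite_UNIV] by blast
  then have "V \<noteq> {}" using assms(1) by auto
  then obtain c where c: "c \<in> V" by blast
  have card: "card (V - {c}) = n - 1" using V c by simp
  \<comment> \<open>The edges at the \<open>t\<close> leaves in \<open>L\<close> receive the extra
    unit; the others keep \<open>r\<close>, which is positive by assumption.\<close>
  then obtain L where L: "L \<subseteq> V - {c}" "card L = t"
    using obtain_subset_with_card_n[of t "V - {c}"] assms(3) by auto
  define S where "S = \<lparr>verts = V, edges = {{c, v} | v. v \<in> V - {c}},
    weight = (\<lambda>e. if \<exists>v\<in>L. e = {c, v} then r + 1 else r)\<rparr>"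
  have E: "edges S = {{c, v} | v. v \<in> verts S - {c}}" by (simp add: S_def)
  have w: "weight S {c, v} = (if v \<in> L then r + 1 else r)" if "v \<in> V - {c}" for v
    using that L by (auto simp: S_def doubleton_eq_iff)
  have "weighted_tree S"
    by (rule star_tree[OF _ _ E]) (use V c w assms(2) in \<open>auto simp: S_def\<close>)
  moreover have "sum (weight S) (edges S) = r * (n - 1) + t"
  proof -
    have "sum (weight S) (edges S) = (\<Sum>v\<in>V - {c}. weight S {c, v})"
      using sum.reindex_bij_betw[OF star_edges_bij[OF E], of "weight S"] by (simp add: S_def)
    also have "\<dots> = (\<Sum>v\<in>V - {c}. r + (if v \<in> L then 1 else 0))"
      by (intro sum.cong) (auto simp: w)
    also have "\<dots> = r * (n - 1) + card ((V - {c}) \<inter> L)"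
      using V(1) card by (simp add: sum.distrib sum.If_cases)
    also have "(V - {c}) \<inter> L = L" using L(1) by blast
    finally show ?thesis using L(2) by simp
  qed
  ultimately have "S \<in> weighted_trees n (r * (n - 1) + t)"
    using V by (simp add: weighted_trees_def S_def)
  moreover have "is_star S" using c E by (auto simp: is_star_def S_def)
  moreover have "weight S e = r \<or> weight S e = r + 1" for e by (simp add: S_def)
  ultimately show thesis using that by blast
qed

text \<open>Half the energy is at least the root of \<open>sq_weight T\<close>, which is at least
  the root of \<open>m * r + t * r + t\<close>. Equality of the outer terms forces both equalities,
  one giving the star and the other the weights.\<close>

lemma tree_energy_bounds:
  assumes n: "n \<ge> 2" and m: "m = r * (n - 1) + t" and T: "T \<in> weighted_trees n m"
  shows "2 * sqrt (real (m * r + t * r + t)) \<le> energy T"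
    and "energy T = 2 * sqrt (real (m * r + t * r + t)) \<longleftrightarrow>
      is_star T \<and> (\<forall>e\<in>edges T. weight T e = r \<or> weight T e = r + 1)"
proof -
  have tree: "weighted_tree T" and cardV: "card (verts T) = n" and sum: "sum (weight T) (edges T) = m"
    using T by (auto simp: weighted_trees_def)
  have G: "weighted_graph T" and acyc: "\<nexists>xs. is_cycle T xs" and ne: "verts T \<noteq> {}"
    using tree by (auto simp: weighted_tree_def connected_graph_def)
  have finV: "finite (verts T)" using G by (simp add: weighted_graph_def)
  have "card (edges T) \<le> n - 1"
    using acyclic_card_edges[OF G acyc ne] cardV by simp
  note sq = sum_squares_ge[OF finite_edges[OF G] this sum[unfolded m], folded m sq_weight_def]
  have "sqrt (real (m * r + t * r + t)) \<le> sqrt (real (sq_weight T))"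
    using sq(1) by (simp only: real_sqrt_le_iff of_nat_le_iff)
  note low = this energy_bounds(1)[OF G]
  then show "2 * sqrt (real (m * r + t * r + t)) \<le> energy T" by linarith
  show "energy T = 2 * sqrt (real (m * r + t * r + t)) \<longleftrightarrow>
      is_star T \<and> (\<forall>e\<in>edges T. weight T e = r \<or> weight T e = r + 1)"
  proof
    assume E: "energy T = 2 * sqrt (real (m * r + t * r + t))"
    then have "sqrt (real (sq_weight T)) = sqrt (real (m * r + t * r + t))"
      using low by linarith
    then have eq: "sq_weight T = m * r + t * r + t"
      by (simp only: real_sqrt_eq_iff of_nat_eq_iff)
    moreover have "is_star T"
      using tree_min_energy_is_star[OF tree] E eq by simp
    ultimately show "is_star T \<and> (\<forall>e\<in>edges T. weight T e = r \<or> weight T e = r + 1)"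
      using sq(2) by blast
  next
    assume R: "is_star T \<and> (\<forall>e\<in>edges T. weight T e = r \<or> weight T e = r + 1)"
    then have "sq_weight T = m * r + t * r + t"
      using sq(3) star_card_edges[OF _ finV] cardV by blast
    then show "energy T = 2 * sqrt (real (m * r + t * r + t))"
      using star_energy[OF G] R n cardV by simp
  qed
qed

theorem theorem2:
  fixes n m r t :: nat
  assumes "n \<ge> 2" and "m \<ge> n - 1"
    and "m = r * (n - 1) + t" and "r = m div (n - 1)" and "t \<le> n - 2"
  shows "(\<exists>S :: 'a::infinite wgraph. S \<in> weighted_trees n m \<and> is_star S \<and>
            as_equal_as_possible (weight S) (edges S)) \<and>
         (\<forall>S :: 'a wgraph. S \<in> weighted_trees n m \<and> is_star S \<and>
            as_equal_as_possible (weight S) (edges S) \<longrightarrow>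
              is_arg_min energy (\<lambda>T. T \<in> weighted_trees n m) S \<and>
              (\<forall>T :: 'a wgraph. is_arg_min energy (\<lambda>T. T \<in> weighted_trees n m) T \<longrightarrow> T \<cong>\<^sub>w S) \<and>
              energy S = 2 * sqrt (real (m * r + t * r + t)))"
proof -
  have fin: "finite (verts T)" if "T \<in> weighted_trees n m" for T :: "'a wgraph"
    using that by (auto simp: weighted_trees_def weighted_tree_def weighted_graph_def)
  \<comment> \<open>A star in this class has \<open>n - 1\<close> edges, so the quotient in
    \<open>as_equal_as_possible\<close> is \<open>r\<close>.\<close>
  have equal_iff: "as_equal_as_possible (weight S) (edges S) \<longleftrightarrow>
      (\<forall>e\<in>edges S. weight S e = r \<or> weight S e = r + 1)"
    if "S \<in> weighted_trees n m" "is_star S" for S :: "'a wgraph"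
    using that star_card_edges[OF that(2) fin[OF that(1)]] assms(4)
    by (simp add: as_equal_as_possible_def weighted_trees_def)
  note bounds = tree_energy_bounds[OF assms(1,3)]
  have "r > 0" using assms(1,2,4) by (simp add: div_greater_zero_iff)
  then obtain S0 :: "'a wgraph" where S0: "S0 \<in> weighted_trees n m" "is_star S0"
    "\<And>e. e \<in> edges S0 \<Longrightarrow> weight S0 e = r \<or> weight S0 e = r + 1"
    using equal_star_exists[of n r t] assms(1,3,5) by (metis diff_le_mono2 le_trans one_le_numeral)
  have S0_energy: "energy S0 = 2 * sqrt (real (m * r + t * r + t))"
    using bounds(2)[OF S0(1)] S0(2,3) by blast
  \<comment> \<open>Because \<open>S0\<close> attains the lower bound, the minimizers are exactly
    the trees attaining it.\<close>
  have arg_min: "is_arg_min energy (\<lambda>T. T \<in> weighted_trees n m) T \<longleftrightarrow>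
      T \<in> weighted_trees n m \<and> energy T = 2 * sqrt (real (m * r + t * r + t))" for T :: "'a wgraph"
    using bounds(1) S0(1) S0_energy unfolding is_arg_min_linorder by (metis order_antisym)
  show ?thesis
  proof (intro conjI allI impI)
    show "\<exists>S :: 'a wgraph. S \<in> weighted_trees n m \<and> is_star S \<and> as_equal_as_possible (weight S) (edges S)"
      using S0 equal_iff by blast
  next
    fix S :: "'a wgraph"
    assume "S \<in> weighted_trees n m \<and> is_star S \<and> as_equal_as_possible (weight S) (edges S)"
    then have S: "S \<in> weighted_trees n m" "is_star S" "\<forall>e\<in>edges S. weight S e = r \<or> weight S e = r + 1"
      using equal_iff by blast+
    show energy: "energy S = 2 * sqrt (real (m * r + t * r + t))"
      using bounds(2)[OF S(1)] S(2,3) by blast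
    show "is_arg_min energy (\<lambda>T. T \<in> weighted_trees n m) S"
      using arg_min S(1) energy by blast
    fix T :: "'a wgraph" assume "is_arg_min energy (\<lambda>T. T \<in> weighted_trees n m) T"
    then have T: "T \<in> weighted_trees n m" "is_star T" "\<forall>e\<in>edges T. weight T e = r \<or> weight T e = r + 1"
      using arg_min bounds(2) by blast+
    show "T \<cong>\<^sub>w S"
    proof (rule equal_stars_iso)
      show "card (verts T) = n" "sum (weight T) (edges T) = r * (n - 1) + t"
        "card (verts S) = n" "sum (weight S) (edges S) = r * (n - 1) + t"
        using S(1) T(1) assms(3) by (simp_all add: weighted_trees_def)
    qed (use S T fin in blast)+
  qed
qed

end
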